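(* Let $\varphi(z)=1+B_1z+B_2z^2+B_3z^3+\cdots$ be analytic in $\mathbb{D}$ with $B_1>0$ and $B_2\in\mathbb{R}$. Let $f(z)=z+\sum_{n\ge2}a_nz^n$ belong to $\sigma$, with inverse $F=f^{-1}$ on $\mathbb{D}$, and suppose \[1+\frac{zf''(z)}{f'(z)}\prec\varphi(z)\quad\text{and}\quad F'(w)\prec\varphi(w)\] (i.e. $f\in\mathcal{K}(\varphi)$ and $F\in\mathcal{R}(\varphi)$). Then \[|a_2|\le\sqrt{\frac{3\,(B_1+|B_2-B_1|)}{8}}\quad\text{and}\quad |a_3|\le\frac{5\,(B_1+|B_2-B_1|)}{12}.\]
   Context: $\mathbb{D}=\{z\in\mathbb{C}:|z|<1\}$. $\mathcal{A}$ denotes the class of analytic functions $f$ on $\mathbb{D}$ with $f(0)=0$, $f'(0)=1$, i.e. $f(z)=z+\sum_{n\ge2}a_nz^n$. The class $\sigma$ of bi-univalent functions consists of those $f\in\mathcal{A}$ that are univalent in $\mathbb{D}$ and whose inverse $f^{-1}$ (defined near $0$) extends to a univalent analytic function $F$ on $\mathbb{D}$; then $F(w)=w-a_2w^2+(2a_2^2-a_3)w^3+\cdots$. For analytic $g,h$ on $\mathbb{D}$, $g\prec h$ (subordination) means there is an analytic $\omega:\mathbb{D}\to\mathbb{D}$ with $\omega(0)=0$ and $g=h\circ\omega$. *)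

theory Defs
  imports "HOL-Analysis.Analysis"
begin

abbreviation unit_disc :: "complex set" where
  "unit_disc \<equiv> ball 0 1"

definition subordinate :: "(complex \<Rightarrow> complex) \<Rightarrow> (complex \<Rightarrow> complex) \<Rightarrow> bool" where
  "subordinate g h \<longleftrightarrow>
     (\<exists>\<omega>. \<omega> holomorphic_on unit_disc \<and> \<omega> ` unit_disc \<subseteq> unit_disc \<and> \<omega> 0 = 0 \<and>
          (\<forall>z\<in>unit_disc. g z = h (\<omega> z)))"

definition class_A :: "(complex \<Rightarrow> complex) \<Rightarrow> bool" where
  "class_A f \<longleftrightarrow> f holomorphic_on unit_disc \<and> f 0 = 0 \<and> deriv f 0 = 1"

text \<open>f is bi-univalent with F the univalent extension to the disc of the inverse
  f^{-1} (which is defined near 0): F coincides with f^{-1} on a neighbourhood of 0.\<close>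
definition bi_univalent_with_inverse ::
  "(complex \<Rightarrow> complex) \<Rightarrow> (complex \<Rightarrow> complex) \<Rightarrow> bool" where
  "bi_univalent_with_inverse f F \<longleftrightarrow>
     class_A f \<and> inj_on f unit_disc \<and>
     F holomorphic_on unit_disc \<and> inj_on F unit_disc \<and>
     (\<exists>r>0. \<forall>w\<in>ball 0 r. F w \<in> unit_disc \<and> f (F w) = w)"

definition coeff0 :: "(complex \<Rightarrow> complex) \<Rightarrow> nat \<Rightarrow> complex" where
  "coeff0 f n = (deriv ^^ n) f 0 / fact n"

end

theory Submission
  imports Defs "HOL-Complex_Analysis.Complex_Analysis"
begin

text \<open>Put \<open>G = 1 + z f'' / f'\<close> and \<open>M = B1 + \<bar>B2 - B1\<bar>\<close>. If \<open>g\<close> is subordinate to \<open>\<phi>\<close> via the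
  Schwarz function \<open>c1 z + c2 z^2 + \<dots>\<close>, its second coefficient is \<open>B1 c2 + B2 c1^2\<close>, and the
  Schwarz--Pick inequality \<open>\<bar>c2\<bar> \<le> 1 - \<bar>c1\<bar>^2\<close> bounds it by \<open>max B1 \<bar>B2\<bar> \<le> M\<close>. Applied to \<open>G\<close> and
  \<open>F'\<close>, whose second coefficients are \<open>X = 6 a3 - 4 a2^2\<close> and \<open>Y = 6 a2^2 - 3 a3\<close>, this gives the
  theorem, because \<open>8 a2^2 = X + 2 Y\<close> and \<open>12 a3 = 3 X + 2 Y\<close>.\<close>

lemma fps_nth_expansion_0: "fps_expansion f 0 $ n = coeff0 f n"
  by (simp add: fps_expansion_def coeff0_def)

lemma has_fps_expansion_nth:
  assumes "f has_fps_expansion P"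
  shows "P $ n = coeff0 f n"
  using fps_nth_fps_expansion[OF assms] by (simp add: coeff0_def)

lemma has_fps_expansion_unit_disc:
  assumes "f holomorphic_on unit_disc"
  shows "f has_fps_expansion fps_expansion f 0"
  using assms by (intro has_fps_expansion_fps_expansion[of unit_disc]) auto

text \<open>Coefficients at 0 depend only on the germ there, so identities known only on the disc,
  such as \<open>g z = \<phi> (w z)\<close>, can be used between total functions.\<close>

lemma coeff0_cong:
  assumes "\<And>z. z \<in> unit_disc \<Longrightarrow> f z = g z"
  shows "coeff0 f n = coeff0 g n"
proof -
  have "eventually (\<lambda>z. z \<in> unit_disc) (nhds 0)"
    by (intro eventually_nhds_in_open) auto
  then have "eventually (\<lambda>z. f z = g z) (nhds 0)"
    by eventually_elim (use assms in auto)
  then show ?thesis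
    unfolding coeff0_def by (simp add: higher_deriv_cong_ev)
qed

text \<open>Since \<open>b\<close> has no constant term, powers of \<open>b\<close> beyond the order
  in question contribute nothing. Order 2 serves the subordinations, orders up to 3 the inversion of
  \<open>f\<close>.\<close>

lemma fps_compose_nth_upto_3:
  fixes a b :: "'a::comm_ring_1 fps"
  assumes "b $ 0 = 0"
  shows "(a oo b) $ 1 = a $ 1 * b $ 1"
    and "(a oo b) $ 2 = a $ 1 * b $ 2 + a $ 2 * (b $ 1)\<^sup>2"
    and "(a oo b) $ 3 = a $ 1 * b $ 3 + 2 * a $ 2 * b $ 1 * b $ 2 + a $ 3 * (b $ 1) ^ 3"
  using assms
  by (simp_all add: fps_compose_nth fps_mult_nth numeral_eq_Suc sum.atLeast0_atMost_Suc algebra_simps)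

text \<open>Divide out the zero: \<open>w z = z * h z\<close> shifts the coefficients, so the claim
  is the Schwarz-Pick bound for \<open>h\<close> at 0. A Moebius map sending \<open>h 0\<close> to 0
  reduces that to the Schwarz lemma.\<close>

lemma Schwarz_second_coeff:
  assumes hol: "w holomorphic_on unit_disc" and im: "w ` unit_disc \<subseteq> unit_disc" and w0: "w 0 = 0"
  shows "cmod (coeff0 w 2) \<le> 1 - (cmod (coeff0 w 1))\<^sup>2"
proof -
  have no: "norm (w z) < 1" if "norm z < 1" for z
    using im that by force
  note Schw = Schwarz_Lemma[OF hol w0 no]
  have c1: "coeff0 w 1 = deriv w 0"
    by (simp add: coeff0_def)
  show ?thesis
  proof (cases "(\<exists>z. norm z < 1 \<and> z \<noteq> 0 \<and> norm (w z) = norm z) \<or> norm (deriv w 0) = 1")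
    \<comment> \<open>Equality in the Schwarz lemma: \<open>w\<close> is a rotation, so
      \<open>h\<close> would be a constant of modulus 1 and leave the open disc. Here both sides of
      the claim are 0.\<close>
    case True
    then obtain a where a: "\<And>z. norm z < 1 \<Longrightarrow> w z = a * z" "norm a = 1"
      using Schw(3)[of 0] by auto
    have "(\<lambda>z. a * z) has_fps_expansion fps_const a * fps_X"
      by (intro fps_expansion_intros)
    then have "coeff0 w n = (fps_const a * fps_X) $ n" for n
      using coeff0_cong[of w "\<lambda>z. a * z"] a(1) by (simp only: has_fps_expansion_nth) simp
    then show ?thesis
      using a(2) by simp
  next
    case False
    obtain h where h: "h holomorphic_on unit_disc" "\<And>z. norm z < 1 \<Longrightarrow> w z = z * h z"
        "deriv w 0 = h 0"
      using Schwarz3[OF hol w0] by metis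
    \<comment> \<open>Strictness comes from excluding equality: in the derivative bound at the
      origin, in \<open>norm (w z) \<le> norm z\<close> elsewhere.\<close>
    have h_less: "norm (h z) < 1" if z: "norm z < 1" for z
    proof (cases "z = 0")
      case True
      then show ?thesis
        using False Schw(2)[of 0] h(3) by auto
    next
      case z0: False
      then have "norm (w z) < norm z"
        using False Schw(1)[OF _ z] z by force
      then show ?thesis
        using h(2)[OF z] z0 by (simp add: norm_mult)
    qed
    define c where "c = h 0"
    define m where "m z = Moebius_function 0 c (h z)" for z
    have c: "norm c < 1"
      using h_less[of 0] by (simp add: c_def)
    have hol_m: "m holomorphic_on unit_disc"
      unfolding m_def
      by (rule holomorphic_on_compose_gen[OF h(1) Moebius_function_holomorphic[OF c], unfolded o_def])
        (use h_less in auto)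
    \<comment> \<open>\<open>m\<close> maps the disc into itself and fixes 0, so the derivative
      bound of the Schwarz lemma applies to it.\<close>
    have m_bound: "cmod (coeff0 m 1) \<le> 1"
      using Schwarz_Lemma(2)[OF hol_m, of 0] Moebius_function_norm_lt_1[OF c h_less]
      by (simp add: m_def c_def Moebius_function_eq_zero coeff0_def)
    have exp_h: "h has_fps_expansion fps_expansion h 0"
      by (rule has_fps_expansion_unit_disc[OF h(1)])
    have w_coeff: "coeff0 w n = (fps_X * fps_expansion h 0) $ n" for n
    proof -
      have "(\<lambda>z. z * h z) has_fps_expansion fps_X * fps_expansion h 0"
        by (intro fps_expansion_intros exp_h)
      then show ?thesis
        using coeff0_cong[of w "\<lambda>z. z * h z"] h(2) by (simp only: has_fps_expansion_nth) simp
    qed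
    have w2: "coeff0 w 2 = coeff0 h 1"
      by (simp add: w_coeff fps_nth_expansion_0)
    have nz: "1 - cnj c * h z \<noteq> 0" if "norm z < 1" for z
    proof -
      have "norm (cnj c * h z) < 1"
        using norm_mult_less[of "cnj c" 1 "h z" 1] c h_less[OF that] by simp
      then show ?thesis
        by (metis norm_one order_less_irrefl right_minus_eq)
    qed
    \<comment> \<open>Clearing the denominator of the Moebius map turns its definition into a
      product identity. In its first coefficient \<open>m 0 = 0\<close> leaves only
      \<open>coeff0 m 1 * (1 - cnj c * c)\<close>.\<close>
    have "(\<lambda>z. m z * (1 - cnj c * h z)) has_fps_expansion
        fps_expansion m 0 * (1 - fps_const (cnj c) * fps_expansion h 0)"
      by (intro fps_expansion_intros exp_h has_fps_expansion_unit_disc hol_m)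
    moreover have "(\<lambda>z. h z - c) has_fps_expansion fps_expansion h 0 - fps_const c"
      by (intro fps_expansion_intros exp_h)
    moreover have "m z * (1 - cnj c * h z) = h z - c" if "z \<in> unit_disc" for z
      using nz[of z] that by (simp add: m_def Moebius_function_simple)
    ultimately have "(fps_expansion m 0 * (1 - fps_const (cnj c) * fps_expansion h 0)) $ 1 =
        (fps_expansion h 0 - fps_const c) $ 1"
      by (metis (no_types, lifting) has_fps_expansion_nth coeff0_cong)
    moreover have "coeff0 m 0 = 0" "coeff0 h 0 = c"
      by (simp_all add: coeff0_def m_def c_def Moebius_function_eq_zero)
    ultimately have "coeff0 h 1 = coeff0 m 1 * (1 - cnj c * c)"
      by (simp add: fps_mult_nth fps_nth_expansion_0)
    moreover have "1 - cnj c * c = of_real (1 - (cmod c)\<^sup>2)"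
      using complex_norm_square[of c] by (simp add: mult.commute)
    moreover have "(cmod c)\<^sup>2 \<le> 1"
      using c by (simp add: power_le_one)
    ultimately have "cmod (coeff0 h 1) = cmod (coeff0 m 1) * (1 - (cmod c)\<^sup>2)"
      by (simp add: norm_mult del: of_real_diff)
    also have "\<dots> \<le> 1 - (cmod c)\<^sup>2"
      using m_bound \<open>(cmod c)\<^sup>2 \<le> 1\<close> by (simp add: mult_left_le_one_le)
    finally show ?thesis
      unfolding w2 c1 h(3) c_def .
  qed
qed

lemma subordinate_second_coeff:
  fixes B1 B2 :: real
  assumes hol: "\<phi> holomorphic_on unit_disc"
    and B1: "coeff0 \<phi> 1 = of_real B1" "B1 > 0" and B2: "coeff0 \<phi> 2 = of_real B2"
    and "subordinate g \<phi>"
  shows "cmod (coeff0 g 2) \<le> B1 + \<bar>B2 - B1\<bar>"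
proof -
  obtain w where w: "w holomorphic_on unit_disc" "w ` unit_disc \<subseteq> unit_disc" "w 0 = 0"
      "\<And>z. z \<in> unit_disc \<Longrightarrow> g z = \<phi> (w z)"
    using assms(5) unfolding subordinate_def by blast
  define W where "W = fps_expansion w 0"
  have W0: "W $ 0 = 0"
    by (simp add: W_def fps_nth_expansion_0 coeff0_def w(3))
  have "(\<phi> \<circ> w) has_fps_expansion (fps_expansion \<phi> 0 oo W)"
    using W0 unfolding W_def
    by (intro has_fps_expansion_compose has_fps_expansion_unit_disc hol w(1))
  then have "coeff0 g 2 = (fps_expansion \<phi> 0 oo W) $ 2"
    using coeff0_cong[of g "\<phi> \<circ> w"] w(4) by (simp add: has_fps_expansion_nth)
  also have "\<dots> = of_real B1 * coeff0 w 2 + of_real B2 * (coeff0 w 1)\<^sup>2"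
    unfolding fps_compose_nth_upto_3[OF W0] by (simp add: W_def fps_nth_expansion_0 B1(1)[simplified] B2)
  finally have "cmod (coeff0 g 2) \<le> B1 * cmod (coeff0 w 2) + \<bar>B2\<bar> * (cmod (coeff0 w 1))\<^sup>2"
    using norm_triangle_ineq[of "of_real B1 * coeff0 w 2" "of_real B2 * (coeff0 w 1)\<^sup>2"] B1(2)
    by (simp add: norm_mult norm_power)
  \<comment> \<open>The triangle inequality splits \<open>\<bar>B2\<bar>\<close> so that the
    \<open>B1\<close> multiples of the squared first coefficient cancel next.\<close>
  also have "\<dots> \<le> B1 * (1 - (cmod (coeff0 w 1))\<^sup>2) + (B1 + \<bar>B2 - B1\<bar>) * (cmod (coeff0 w 1))\<^sup>2"
    using Schwarz_second_coeff[OF w(1-3)] B1(2) by (intro add_mono mult_mono) auto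
  also have "\<dots> = B1 + \<bar>B2 - B1\<bar> * (cmod (coeff0 w 1))\<^sup>2"
    by (simp add: algebra_simps)
  also have "\<dots> \<le> B1 + \<bar>B2 - B1\<bar> * 1"
  proof (intro add_left_mono mult_left_mono)
    show "(cmod (coeff0 w 1))\<^sup>2 \<le> 1"
      using Schwarz_second_coeff[OF w(1-3)] norm_ge_zero[of "coeff0 w 2"] by linarith
  qed auto
  finally show ?thesis by simp
qed

lemma convexity_quotient_second_coeff:
  assumes "class_A f"
  shows "coeff0 (\<lambda>z. 1 + z * deriv (deriv f) z / deriv f z) 2 = 6 * coeff0 f 3 - 4 * (coeff0 f 2)\<^sup>2"
proof -
  define P where "P = fps_expansion f 0"
  have f: "f has_fps_expansion P"
    using assms unfolding class_A_def P_def by (intro has_fps_expansion_unit_disc) auto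
  have P1: "P $ 1 = 1"
    using assms by (simp add: P_def fps_nth_expansion_0 coeff0_def class_A_def)
  define G where "G = 1 + fps_X * fps_deriv (fps_deriv P) / fps_deriv P"
  have "(\<lambda>z. 1 + z * deriv (deriv f) z / deriv f z) has_fps_expansion G"
    unfolding G_def using P1 by (intro fps_expansion_intros has_fps_expansion_divide' f) auto
  then have "coeff0 (\<lambda>z. 1 + z * deriv (deriv f) z / deriv f z) 2 = G $ 2"
    by (simp add: has_fps_expansion_nth)
  \<comment> \<open>As \<open>f'(0) = 1\<close>, the series of \<open>f'\<close> is a unit and the
    quotient can be cleared. Orders 0, 1, 2 then give in turn \<open>G $ 0 = 1\<close>,
    \<open>G $ 1 = 2 * P $ 2\<close> and \<open>G $ 2\<close>.\<close>
  moreover have "(G - 1) * fps_deriv P = fps_X * fps_deriv (fps_deriv P)"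
  proof -
    have "is_unit (fps_deriv P)"
      using P1 by (simp add: fps_is_unit_iff)
    then show ?thesis
      by (simp add: G_def)
  qed
  then have "((G - 1) * fps_deriv P) $ n = (fps_X * fps_deriv (fps_deriv P)) $ n" for n
    by simp
  from this[of 0] this[of 1] this[of 2] P1
  have "G $ 2 = 6 * P $ 3 - 4 * (P $ 2)\<^sup>2"
    by (simp add: fps_mult_nth numeral_eq_Suc algebra_simps)
  ultimately show ?thesis
    by (simp add: P_def fps_nth_expansion_0)
qed

text \<open>Comparing coefficients in \<open>f (F w) = w\<close> up to order 3 determines those of
  \<open>F\<close>; differentiation multiplies the third one by 3.\<close>

lemma inverse_deriv_second_coeff:
  assumes "bi_univalent_with_inverse f F"
  shows "coeff0 (deriv F) 2 = 6 * (coeff0 f 2)\<^sup>2 - 3 * coeff0 f 3"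
proof -
  obtain r where A: "class_A f" and inj: "inj_on f unit_disc" and hol: "F holomorphic_on unit_disc"
    and r: "r > 0" "\<And>w. w \<in> ball 0 r \<Longrightarrow> F w \<in> unit_disc \<and> f (F w) = w"
    using assms unfolding bi_univalent_with_inverse_def by blast
  define P where "P = fps_expansion f 0"
  define Q where "Q = fps_expansion F 0"
  have f: "f has_fps_expansion P" and F: "F has_fps_expansion Q"
    using A hol unfolding class_A_def P_def Q_def by (auto intro!: has_fps_expansion_unit_disc)
  have P1: "P $ 1 = 1"
    using A by (simp add: P_def fps_nth_expansion_0 coeff0_def class_A_def)
  \<comment> \<open>\<open>F 0\<close> lies in the disc and \<open>f (F 0) = 0 = f 0\<close>, so
    injectivity applies. The formal composition \<open>P oo Q\<close> needs this zero constant
    term.\<close>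
  have "F 0 = 0"
    using inj r(2)[of 0] r(1) A by (auto simp: class_A_def dest: inj_onD[of f unit_disc "F 0" 0])
  then have Q0: "Q $ 0 = 0"
    by (simp add: Q_def fps_nth_expansion_0 coeff0_def)
  have "eventually (\<lambda>w. w \<in> ball 0 r) (nhds 0)"
    using r(1) by (intro eventually_nhds_in_open) auto
  then have "eventually (\<lambda>w. (f \<circ> F) w = w) (nhds 0)"
    by eventually_elim (use r(2) in auto)
  moreover have "(f \<circ> F) has_fps_expansion (P oo Q)"
    by (intro has_fps_expansion_compose f F Q0)
  ultimately have "(\<lambda>w. w) has_fps_expansion (P oo Q)"
    using has_fps_expansion_cong[of "f \<circ> F" "\<lambda>w. w" "P oo Q"] by blast
  then have "P oo Q = fps_X"
    by (rule fps_expansion_unique_complex) (rule has_fps_expansion_fps_X)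
  then have "(P oo Q) $ 1 = 1" "(P oo Q) $ 2 = 0" "(P oo Q) $ 3 = 0"
    by simp_all
  then have Q1: "Q $ 1 = 1" and Q2: "Q $ 2 = - P $ 2"
    and Q3: "Q $ 3 + 2 * P $ 2 * Q $ 2 + P $ 3 = 0"
    unfolding fps_compose_nth_upto_3[OF Q0] P1 by (simp_all add: add_eq_0_iff2)
  have "Q $ 3 = 2 * (P $ 2)\<^sup>2 - P $ 3"
    using Q3 unfolding Q2 by (simp add: power2_eq_square algebra_simps add_eq_0_iff)
  moreover have "coeff0 (deriv F) 2 = 3 * Q $ 3"
    using has_fps_expansion_nth[OF has_fps_expansion_deriv[OF F], of 2]
    by (simp add: numeral_eq_Suc)
  ultimately show ?thesis
    by (simp add: P_def fps_nth_expansion_0 right_diff_distrib)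
qed

theorem theorem4:
  fixes \<phi> f F :: "complex \<Rightarrow> complex" and B1 B2 :: real
  assumes "\<phi> holomorphic_on unit_disc"
    and "\<phi> 0 = 1"
    and "coeff0 \<phi> 1 = complex_of_real B1" and "B1 > 0"
    and "coeff0 \<phi> 2 = complex_of_real B2"
    and "bi_univalent_with_inverse f F"
    and "subordinate (\<lambda>z. 1 + z * deriv (deriv f) z / deriv f z) \<phi>"
    and "subordinate (deriv F) \<phi>"
  shows "cmod (coeff0 f 2) \<le> sqrt (3 * (B1 + \<bar>B2 - B1\<bar>) / 8) \<and>
         cmod (coeff0 f 3) \<le> 5 * (B1 + \<bar>B2 - B1\<bar>) / 12"
proof -
  define M where "M = B1 + \<bar>B2 - B1\<bar>"
  define X where "X = 6 * coeff0 f 3 - 4 * (coeff0 f 2)\<^sup>2"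
  define Y where "Y = 6 * (coeff0 f 2)\<^sup>2 - 3 * coeff0 f 3"
  have "class_A f"
    using assms(6) by (simp add: bi_univalent_with_inverse_def)
  then have X: "cmod X \<le> M" and Y: "cmod Y \<le> M"
    using subordinate_second_coeff[OF assms(1,3-5) assms(7)]
      subordinate_second_coeff[OF assms(1,3-5) assms(8)] assms(6)
    by (simp_all add: X_def Y_def M_def convexity_quotient_second_coeff inverse_deriv_second_coeff)
  \<comment> \<open>The weights 1 and 2 cancel \<open>a3\<close>, and their sum gives the factor 3
    in the bound.\<close>
  have "8 * (cmod (coeff0 f 2))\<^sup>2 = cmod (X + 2 * Y)"
    by (simp add: X_def Y_def norm_mult flip: norm_power)
  also have "\<dots> \<le> 3 * M"
    using norm_triangle_ineq[of X "2 * Y"] X Y by (simp add: norm_mult)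
  finally have "cmod (coeff0 f 2) \<le> sqrt (3 * M / 8)"
    by (intro real_le_rsqrt) simp
  \<comment> \<open>The weights 3 and 2 cancel the square of \<open>a2\<close>, and their sum gives
    the factor 5.\<close>
  moreover have "12 * cmod (coeff0 f 3) = cmod (3 * X + 2 * Y)"
    by (simp add: X_def Y_def norm_mult)
  then have "cmod (coeff0 f 3) \<le> 5 * M / 12"
    using norm_triangle_ineq[of "3 * X" "2 * Y"] X Y by (simp add: norm_mult)
  ultimately show ?thesis
    by (simp add: M_def)
qed

end
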